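(* Let $X$ be a real or complex Banach space and let $(A(n))_{n\in\mathbb{N}}$ be a sequence in $\mathcal{B}(X)$. The linear discrete-time system $x_{n+1}=A(n)x_n$, $n\in\mathbb{N}$, is uniformly power instable (UPIS) if and only if there are constants $p\in(0,+\infty)$, $D\ge 1$, $d>1$ such that $$\sum_{k=n}^{m} d^{\,p(m-k)}\,\|\mathcal{A}(k,n)x\|^{p}\le D^{p}\,\|\mathcal{A}(m,n)x\|^{p}$$ for all $(m,n,x)\in\Delta\times X$.
   Context: $\mathcal{B}(X)$ is the space of bounded linear operators on $X$; $\|\cdot\|$ denotes the norm on $X$. $\mathbb{N}=\{0,1,2,\dots\}$ and $\Delta=\{(m,n)\in\mathbb{N}^2: m\ge n\}$. For $(m,n)\in\Delta$, $\mathcal{A}(m,n)=A(m-1)\cdots A(n)$ if $m\ge n+1$ and $\mathcal{A}(n,n)=I$ (the identity). The system is uniformly power instable (UPIS) if there are constants $N\ge 1$ and $r\in(0,1)$ such that $\|\mathcal{A}(n,l)x\|\le N\,r^{m-n}\,\|\mathcal{A}(m,l)x\|$ for all $m,n,l\in\mathbb{N}$ with $m\ge n\ge l$ and all $x\in X$. *)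

theory Defs
  imports Complex_Main "HOL-Analysis.Bounded_Linear_Function"
begin

text \<open>
  The class \<open>banach\<close> consists of the Banach spaces over the reals. Complex Banach spaces are
  covered by restriction of scalars: the norm and completeness are unchanged, and a bounded
  complex-linear operator is in particular a bounded real-linear one. The notions below
  involve only composition of operators and norms of vectors, so they do not depend on the
  scalar field.
\<close>

text \<open>
  The product \<open>A(m-1) \<cdots> A(n)\<close> for \<open>m \<ge> n\<close>, with the factor of largest index outermost;
  for \<open>m < n\<close> the value is the identity by convention and is never used.
\<close>

primrec evolution ::
    "(nat \<Rightarrow> 'a::real_normed_vector \<Rightarrow>\<^sub>L 'a) \<Rightarrow> nat \<Rightarrow> nat \<Rightarrow> 'a \<Rightarrow>\<^sub>L 'a" where
  "evolution A 0 n = id_blinfun"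
| "evolution A (Suc m) n = (if n \<le> m then A m o\<^sub>L evolution A m n else id_blinfun)"

definition UPIS :: "(nat \<Rightarrow> 'a::real_normed_vector \<Rightarrow>\<^sub>L 'a) \<Rightarrow> bool" where
  "UPIS A \<longleftrightarrow> (\<exists>(N::real) (r::real). N \<ge> 1 \<and> 0 < r \<and> r < 1 \<and>
     (\<forall>m n l x. l \<le> n \<longrightarrow> n \<le> m \<longrightarrow>
        norm (blinfun_apply (evolution A n l) x)
          \<le> N * r ^ (m - n) * norm (blinfun_apply (evolution A m l) x)))"

end

theory Submission imports Defs begin

text \<open>
  For fixed \<open>n\<close> and \<open>x\<close>, both conditions constrain only the sequence
  \<open>k \<mapsto> \<parallel>A(k-1) \<cdots> A(n) x\<parallel>\<close>, so the equivalence reduces to two facts on nonnegative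
  numbers, with constants that do not depend on \<open>n\<close> and \<open>x\<close>.

  If the sequence satisfies \<open>a k \<le> N r\<^sup>m\<^sup>-\<^sup>k a m\<close>, the decay rate \<open>r\<close> is split into two equal
  factors: the weight \<open>d = 1 / sqrt r\<close> consumes one of them, and the remaining factors
  \<open>(sqrt r)\<^sup>m\<^sup>-\<^sup>k\<close> are dominated by a geometric series. This gives the sum condition with \<open>p = 1\<close>
  (lemma \<open>geometric_decay_imp_weighted_sum_le\<close>). Conversely, each single term of the weighted
  sum is bounded by the whole sum, and extracting \<open>p\<close>-th roots gives decay with rate \<open>1 / d\<close>
  (lemma \<open>weighted_sum_le_imp_geometric_decay\<close>).
\<close>

text \<open>
  With \<open>s\<close> the square root of the decay rate, the summand of index \<open>k\<close> is at most
  \<open>N s\<^sup>m\<^sup>-\<^sup>k a m\<close>, and the geometric series in \<open>s\<close> has sum \<open>1 / (1 - s)\<close>.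
\<close>

lemma geometric_decay_imp_weighted_sum_le:
  fixes a :: "nat \<Rightarrow> real"
  assumes s: "0 < s" "s < 1" and "0 \<le> N" and "0 \<le> a m"
    and decay: "\<And>k. n \<le> k \<Longrightarrow> k \<le> m \<Longrightarrow> a k \<le> N * (s\<^sup>2) ^ (m - k) * a m"
  shows "(\<Sum>k=n..m. (1 / s) ^ (m - k) * a k) \<le> N / (1 - s) * a m"
proof -
  have "(\<Sum>k=n..m. (1 / s) ^ (m - k) * a k) \<le> (\<Sum>k=n..m. N * a m * s ^ (m - k))"
  proof (rule sum_mono)
    fix k assume "k \<in> {n..m}"
    then have "(1 / s) ^ (m - k) * a k \<le> (1 / s) ^ (m - k) * (N * (s\<^sup>2) ^ (m - k) * a m)"
      using s decay by (intro mult_left_mono) auto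
    also have "\<dots> = N * a m * ((1 / s) * s\<^sup>2) ^ (m - k)"
      unfolding power_mult_distrib[of "1 / s" "s\<^sup>2"] by (simp only: ac_simps)
    also have "(1 / s) * s\<^sup>2 = s"
      using s by (simp add: power2_eq_square)
    finally show "(1 / s) ^ (m - k) * a k \<le> N * a m * s ^ (m - k)" .
  qed
  also have "\<dots> = N * a m * (\<Sum>k=n..m. s ^ (m - k))"
    by (simp add: sum_distrib_left)
  also have "(\<Sum>k=n..m. s ^ (m - k)) \<le> (\<Sum>k\<le>m. s ^ (m - k))"
    using s by (intro sum_mono2) auto
  also have "(\<Sum>k\<le>m. s ^ (m - k)) = (\<Sum>j\<le>m. s ^ j)"
    by (rule sum.nat_diff_reindex[of _ "Suc m", unfolded lessThan_Suc_atMost, simplified])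
  also have "(\<Sum>j\<le>m. s ^ j) \<le> (\<Sum>j. s ^ j)"
    using s by (intro sum_le_suminf summable_geometric) auto
  also have "\<dots> = 1 / (1 - s)"
    using s by (simp add: suminf_geometric)
  finally show ?thesis
    using assms(3,4) by (simp add: mult_left_mono)
qed

lemma weighted_sum_le_imp_geometric_decay:
  fixes a :: "nat \<Rightarrow> real"
  assumes "0 < p" and "0 \<le> D" and "0 < d" and nonneg: "\<And>k. 0 \<le> a k"
    and k: "n \<le> k" "k \<le> m"
    and sum_le: "(\<Sum>k=n..m. d powr (p * real (m - k)) * a k powr p) \<le> D powr p * a m powr p"
  shows "a k \<le> D * (1 / d) ^ (m - k) * a m"
proof -
  have "(d ^ (m - k) * a k) powr p = d powr (p * real (m - k)) * a k powr p"
    using \<open>0 < d\<close> nonneg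
    by (simp add: powr_mult powr_powr mult.commute flip: powr_realpow)
  also have "\<dots> \<le> (\<Sum>k=n..m. d powr (p * real (m - k)) * a k powr p)"
    using k by (intro member_le_sum) auto
  also have "\<dots> \<le> (D * a m) powr p"
    using sum_le \<open>0 \<le> D\<close> nonneg by (simp add: powr_mult)
  finally have "d ^ (m - k) * a k \<le> D * a m"
    using \<open>0 < p\<close> \<open>0 \<le> D\<close> \<open>0 < d\<close> nonneg powr_less_mono2[of p "D * a m" "d ^ (m - k) * a k"]
    by fastforce
  then show ?thesis
    using \<open>0 < d\<close> by (simp add: field_simps)
qed

theorem corollary4:
  fixes A :: "nat \<Rightarrow> 'a::banach \<Rightarrow>\<^sub>L 'a"
  shows "UPIS A \<longleftrightarrow>
    (\<exists>(p::real) (D::real) (d::real). 0 < p \<and> D \<ge> 1 \<and> d > 1 \<and>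
      (\<forall>m n x. n \<le> m \<longrightarrow>
        (\<Sum>k=n..m. d powr (p * real (m - k)) * norm (blinfun_apply (evolution A k n) x) powr p)
          \<le> D powr p * norm (blinfun_apply (evolution A m n) x) powr p))"
proof
  assume "UPIS A"
  then obtain N r where N: "N \<ge> 1" and r: "0 < r" "r < 1"
    and decay: "\<And>m n l x. l \<le> n \<Longrightarrow> n \<le> m \<Longrightarrow>
        norm (evolution A n l x) \<le> N * r ^ (m - n) * norm (evolution A m l x)"
    unfolding UPIS_def by blast
  define s where "s = sqrt r"
  have s: "0 < s" "s < 1" and s2: "s\<^sup>2 = r"
    using r by (auto simp: s_def)
  have "N / (1 - s) \<ge> 1" and "1 / s > 1"
    using N s by (auto simp: field_simps)
  moreover have "(\<Sum>k=n..m. (1 / s) powr (1 * real (m - k)) * norm (evolution A k n x) powr 1)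
      \<le> (N / (1 - s)) powr 1 * norm (evolution A m n x) powr 1" for m n x
    using geometric_decay_imp_weighted_sum_le[of s N "\<lambda>k. norm (evolution A k n x)" m n]
      s N decay \<open>N / (1 - s) \<ge> 1\<close> by (simp add: s2 powr_realpow del: of_nat_diff)
  ultimately show "\<exists>p D d. 0 < p \<and> D \<ge> 1 \<and> d > 1 \<and>
      (\<forall>m n x. n \<le> m \<longrightarrow>
        (\<Sum>k=n..m. d powr (p * real (m - k)) * norm (evolution A k n x) powr p)
          \<le> D powr p * norm (evolution A m n x) powr p)"
    using zero_less_one by blast
next
  assume "\<exists>p D d. 0 < p \<and> D \<ge> 1 \<and> d > 1 \<and>
      (\<forall>m n x. n \<le> m \<longrightarrow>
        (\<Sum>k=n..m. d powr (p * real (m - k)) * norm (evolution A k n x) powr p)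
          \<le> D powr p * norm (evolution A m n x) powr p)"
  then obtain p D d where "0 < p" "D \<ge> 1" "d > 1"
    and sum_le: "\<And>m n x. n \<le> m \<Longrightarrow>
        (\<Sum>k=n..m. d powr (p * real (m - k)) * norm (evolution A k n x) powr p)
          \<le> D powr p * norm (evolution A m n x) powr p"
    by blast
  have "norm (evolution A n l x) \<le> D * (1 / d) ^ (m - n) * norm (evolution A m l x)"
    if "l \<le> n" "n \<le> m" for m n l x
    using \<open>0 < p\<close> \<open>D \<ge> 1\<close> \<open>d > 1\<close> that sum_le
    by (intro weighted_sum_le_imp_geometric_decay[of p D d "\<lambda>k. norm (evolution A k l x)" l]) auto
  moreover have "0 < 1 / d" and "1 / d < 1"
    using \<open>d > 1\<close> by auto
  ultimately show "UPIS A"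
    unfolding UPIS_def using \<open>D \<ge> 1\<close> by blast
qed

end
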